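(* Let $\mathcal{A}$ be a finite alphabet, let $d\ge1$ and $0\le k\le d$, let $p_1,\dots,p_k\ge2$ be integers, and let $\Omega_1,\dots,\Omega_k,X_{k+1},\dots,X_d\subseteq\mathcal{A}^{\mathbb{N}}$ be subshifts. The entropy of the axial product of $X_{\Omega_1}^{p_1},\dots,X_{\Omega_k}^{p_k},X_{k+1},\dots,X_d$ on $\mathbb{N}^d$ is $$h\left(\otimes_{i=1}^kX_{\Omega_i}^{p_i}\otimes_{j=k+1}^dX_j\right)=\prod_{i=1}^k\frac{(p_i-1)^2}{p_i^2}\sum_{i_1,\dots,i_k=1}^\infty\frac{\lambda_{i_1,\dots,i_k}}{\prod_{j=1}^kp_j^{i_j-1}},$$ where $$\lambda_{i_1,\dots,i_k}=\lim_{i_{k+1},\dots,i_d\to\infty}\frac{\log\left|\mathcal{P}\left([1,i_1]\times\cdots\times[1,i_d],\ \otimes_{i=1}^k\Omega_i\otimes_{j=k+1}^dX_j\right)\right|}{\prod_{j=k+1}^di_j}.$$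
   Context: $\mathbb{N}=\{1,2,\dots\}$, $[1,n]=\{1,\dots,n\}$. A subshift is a closed shift-invariant subset of $\mathcal{A}^{\mathbb{N}}$. The multiplicative subshift is $X_\Omega^p=\{x\in\mathcal{A}^{\mathbb{N}}:(x_{ip^l})_{l=0}^\infty\in\Omega\text{ for all }i\in\mathbb{N}\text{ with }p\nmid i\}$. For $Y_1,\dots,Y_d\subseteq\mathcal{A}^{\mathbb{N}}$, the axial product $Y_1\otimes\cdots\otimes Y_d\subseteq\mathcal{A}^{\mathbb{N}^d}$ is the set of $x\in\mathcal{A}^{\mathbb{N}^d}$ such that for every $i\in\{1,\dots,d\}$ and every $g\in\mathbb{N}^d$ with $i$-th coordinate equal to $1$, the sequence $(x_{g+je_i})_{j=0}^\infty$ (regarded as an element of $\mathcal{A}^{\mathbb{N}}$ with $(j+1)$-st entry $x_{g+je_i}$) lies in $Y_i$, where $e_1,\dots,e_d$ is the standard basis. For finite $\Lambda\subseteq\mathbb{N}^d$ and $Z\subseteq\mathcal{A}^{\mathbb{N}^d}$, $\mathcal{P}(\Lambda,Z)=\{(x_g)_{g\in\Lambda}:x\in Z\}$. The entropy is $h(Z)=\lim_{n\to\infty}\frac{\log|\mathcal{P}([1,n]^d,Z)|}{n^d}$. Empty products equal $1$; if $k=d$ there is no limit in the definition of $\lambda_{i_1,\dots,i_k}$, and if $k=0$ the sum consists of the single term $\lambda$. *)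

theory Defs
  imports "HOL-Analysis.Analysis"
begin

text \<open>
  The positive integers are the set \<open>{1..}\<close> of type \<open>nat set\<close>, and \<open>d\<close>-tuples of them are
  extensional functions on \<open>{1..d}\<close>, so that \<open>d = 0\<close> gives exactly one (empty) tuple.
  Configurations are likewise extensional functions into the alphabet \<open>A\<close>.
\<close>

definition seqs :: "'a set \<Rightarrow> (nat \<Rightarrow> 'a) set" where
  "seqs A = {1..} \<rightarrow>\<^sub>E A"

definition tuples :: "nat \<Rightarrow> (nat \<Rightarrow> nat) set" where
  "tuples d = {1..d} \<rightarrow>\<^sub>E {1..}"

definition configs :: "'a set \<Rightarrow> nat \<Rightarrow> ((nat \<Rightarrow> nat) \<Rightarrow> 'a) set" where
  "configs A d = tuples d \<rightarrow>\<^sub>E A"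

definition shift :: "(nat \<Rightarrow> 'a) \<Rightarrow> nat \<Rightarrow> 'a" where
  "shift x = (\<lambda>n\<in>{1..}. x (n + 1))"

text \<open>
  The shift on one-sided sequences is not invertible; invariance means \<open>shift ` X \<subseteq> X\<close>, with
  no surjectivity required. A closed set is a subset of the topological space \<open>seqs A\<close>.
\<close>

definition subshift :: "'a set \<Rightarrow> (nat \<Rightarrow> 'a) set \<Rightarrow> bool" where
  "subshift A X \<longleftrightarrow>
     closedin (product_topology (\<lambda>_. discrete_topology A) {1..}) X \<and> shift ` X \<subseteq> X"

text \<open>The \<open>m\<close>-th entry, \<open>m \<ge> 1\<close>, of the sequence \<open>(x\<^sub>i, x\<^sub>i\<^sub>p, x\<^sub>i\<^sub>p\<^sub>p, \<dots>)\<close> is \<open>x (i * p ^ (m - 1))\<close>.\<close>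

definition mult_subshift :: "'a set \<Rightarrow> nat \<Rightarrow> (nat \<Rightarrow> 'a) set \<Rightarrow> (nat \<Rightarrow> 'a) set" where
  "mult_subshift A p \<Omega> =
     {x \<in> seqs A. \<forall>i\<ge>1. \<not> p dvd i \<longrightarrow> (\<lambda>m\<in>{1..}. x (i * p ^ (m - 1))) \<in> \<Omega>}"

text \<open>
  If the \<open>i\<close>-th coordinate of \<open>g\<close> is \<open>1\<close>, then adding \<open>m - 1\<close> times the \<open>i\<close>-th standard basis
  vector to \<open>g\<close> gives \<open>g(i := m)\<close>.
\<close>

definition axial_product ::
    "'a set \<Rightarrow> nat \<Rightarrow> (nat \<Rightarrow> (nat \<Rightarrow> 'a) set) \<Rightarrow> ((nat \<Rightarrow> nat) \<Rightarrow> 'a) set" where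
  "axial_product A d Y =
     {x \<in> configs A d. \<forall>i\<in>{1..d}. \<forall>g\<in>tuples d.
        g i = 1 \<longrightarrow> (\<lambda>m\<in>{1..}. x (g(i := m))) \<in> Y i}"

definition patterns ::
    "(nat \<Rightarrow> nat) set \<Rightarrow> ((nat \<Rightarrow> nat) \<Rightarrow> 'a) set \<Rightarrow> ((nat \<Rightarrow> nat) \<Rightarrow> 'a) set" where
  "patterns \<Lambda> Z = (\<lambda>x. restrict x \<Lambda>) ` Z"

definition int_box :: "nat \<Rightarrow> (nat \<Rightarrow> nat) \<Rightarrow> (nat \<Rightarrow> nat) set" where
  "int_box d n = (\<Pi>\<^sub>E j\<in>{1..d}. {1..n j})"

text \<open>
  For nonempty \<open>Z\<close> the pattern counts below are positive. For empty \<open>Z\<close> all of them are \<open>0\<close> and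
  the library convention \<open>ln 0 = 0\<close> applies.
\<close>

definition entropy_seq :: "nat \<Rightarrow> ((nat \<Rightarrow> nat) \<Rightarrow> 'a) set \<Rightarrow> nat \<Rightarrow> real" where
  "entropy_seq d Z n = ln (real (card (patterns (int_box d (\<lambda>_. n)) Z))) / real n ^ d"

definition entropy :: "nat \<Rightarrow> ((nat \<Rightarrow> nat) \<Rightarrow> 'a) set \<Rightarrow> real" where
  "entropy d Z = lim (entropy_seq d Z)"

text \<open>
  The coordinates with index in \<open>J\<close> tend to infinity jointly and independently of each other.
  For \<open>J = {}\<close> this is the trivial filter \<open>principal UNIV\<close>, along which a constant
  function tends to its value only, i.e. no limit is taken.
\<close>

definition coords_at_top :: "nat set \<Rightarrow> (nat \<Rightarrow> nat) filter" where
  "coords_at_top J = (INF N. principal {n. \<forall>j\<in>J. N \<le> n j})"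

text \<open>
  The first \<open>k\<close> side lengths are given by \<open>i\<close>, the others by \<open>n\<close>.
\<close>

definition lambda_net ::
    "nat \<Rightarrow> nat \<Rightarrow> ((nat \<Rightarrow> nat) \<Rightarrow> 'a) set \<Rightarrow> (nat \<Rightarrow> nat) \<Rightarrow> (nat \<Rightarrow> nat) \<Rightarrow> real" where
  "lambda_net d k Z i n =
     ln (real (card (patterns (int_box d (\<lambda>j. if j \<le> k then i j else n j)) Z)))
       / (\<Prod>j=k+1..d. real (n j))"

definition lambda_lim ::
    "nat \<Rightarrow> nat \<Rightarrow> ((nat \<Rightarrow> nat) \<Rightarrow> 'a) set \<Rightarrow> (nat \<Rightarrow> nat) \<Rightarrow> real" where
  "lambda_lim d k Z i = Lim (coords_at_top {k+1..d}) (lambda_net d k Z i)"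

end

theory Submission
  imports Defs
begin

text \<open>
  Every \<open>n \<ge> 1\<close> is uniquely \<open>q p\<^sup>l\<close> with \<open>p\<close> not dividing \<open>q\<close>. Hence the lattice splits into
  orbits indexed by the tuples \<open>q\<close> of non-multiples, and the axial product \<open>Z\<close> of the statement is
  the product over all \<open>q\<close> of independent copies of \<open>W\<close>. An orbit meets the cube of side \<open>n\<close> in a box
  with side lengths \<open>i\<^sub>1, \<dots>, i\<^sub>k, n, \<dots>, n\<close>, and the proportion of tuples \<open>q\<close> with prescribed
  \<open>i\<close> tends to the product of \<open>(p\<^sub>j - 1)\<^sup>2 / p\<^sub>j\<^sup>2 / p\<^sub>j ^ (i\<^sub>j - 1)\<close>. The limits \<open>\<lambda>\<close> exist
  by subadditivity in the shift-invariant directions, and dominated convergence, with summable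
  bound \<open>ln |A|\<close> times the product of \<open>i\<^sub>j / p\<^sub>j ^ (i\<^sub>j - 1)\<close>, allows summing the limits.
\<close>

section \<open>Patterns and translations\<close>

lemma tuples_upd: "g \<in> tuples d \<Longrightarrow> i \<in> {1..d} \<Longrightarrow> 1 \<le> m \<Longrightarrow> g(i := m) \<in> tuples d"
  by (auto simp: tuples_def PiE_iff extensional_def)

lemma int_box_subset_tuples: "int_box d n \<subseteq> tuples d"
  unfolding int_box_def tuples_def by (intro PiE_mono) auto

lemma finite_int_box: "finite (int_box d n)"
  unfolding int_box_def by (intro finite_PiE) auto

lemma card_int_box: "card (int_box d n) = (\<Prod>j\<in>{1..d}. n j)"
  unfolding int_box_def by (simp add: card_PiE)

lemma axial_product_subset_configs: "axial_product A d Y \<subseteq> configs A d"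
  by (auto simp: axial_product_def)

lemma configs_app: "x \<in> configs A d \<Longrightarrow> g \<in> tuples d \<Longrightarrow> x g \<in> A"
  by (auto simp: configs_def)

lemma patterns_subset_PiE:
  assumes "W \<subseteq> configs A d" "B \<subseteq> tuples d"
  shows "patterns B W \<subseteq> (B \<rightarrow>\<^sub>E A)"
  unfolding patterns_def
proof (rule image_subsetI)
  fix x assume "x \<in> W"
  then have "x \<in> configs A d" using assms(1) by blast
  then show "restrict x B \<in> B \<rightarrow>\<^sub>E A"
    using assms(2) by (auto simp: configs_def intro!: PiE_mem[of x "tuples d"])
qed

lemma finite_patterns:
  assumes "W \<subseteq> configs A d" "finite A" "B \<subseteq> tuples d" "finite B"
  shows "finite (patterns B W)"
  by (rule finite_subset[OF patterns_subset_PiE[OF assms(1,3)]])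
    (intro finite_PiE assms)

lemma card_patterns_le:
  assumes "W \<subseteq> configs A d" "finite A" "B \<subseteq> tuples d" "finite B"
  shows "card (patterns B W) \<le> card A ^ card B"
proof -
  have "card (patterns B W) \<le> card (B \<rightarrow>\<^sub>E A)"
    by (rule card_mono[OF finite_PiE patterns_subset_PiE]) (use assms in auto)
  then show ?thesis using assms(4) by (simp add: card_PiE)
qed

text \<open>On \<open>W\<close> the map \<open>f\<close> factors through \<open>\<phi>\<close>, so
  its image is an image of that of \<open>\<phi>\<close>. Pattern counts are bounded by choosing an
  encoding \<open>\<phi>\<close> from which the pattern can be recovered.\<close>

lemma card_image_le_via:
  assumes "\<And>x y. x \<in> W \<Longrightarrow> y \<in> W \<Longrightarrow> \<phi> x = \<phi> y \<Longrightarrow> f x = f y" "finite (\<phi> ` W)"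
  shows "card (f ` W) \<le> card (\<phi> ` W)"
proof -
  have "f ` W = (\<lambda>u. f (inv_into W \<phi> u)) ` \<phi> ` W"
    unfolding image_image
    by (intro image_cong refl assms(1)) (auto simp: inv_into_into f_inv_into_f)
  then show ?thesis using card_image_le[OF assms(2)] by metis
qed

lemma shift_funpow:
  "(shift ^^ t) (\<lambda>m\<in>{1..}. f m) = (\<lambda>m\<in>{1..}. f (m + t))"
proof (induction t)
  case (Suc t)
  have "(shift ^^ Suc t) (\<lambda>m\<in>{1..}. f m) = shift (\<lambda>m\<in>{1..}. f (m + t))"
    by (simp only: funpow.simps o_apply Suc)
  also have "\<dots> = (\<lambda>m\<in>{1..}. f (m + Suc t))"
    by (auto simp: shift_def restrict_def fun_eq_iff)
  finally show ?case .
qed simp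

lemma axial_productD:
  assumes "x \<in> axial_product A d Y" "i \<in> {1..d}" "g \<in> tuples d" "g i = 1"
  shows "(\<lambda>m\<in>{1..}. x (g(i := m))) \<in> Y i"
  using assms by (simp add: axial_product_def)

text \<open>A line of the translate in direction \<open>i\<close> is a line of \<open>x\<close> with
  its first \<open>t i\<close> entries removed, and invariance of \<open>Y i\<close> keeps it in
  \<open>Y i\<close>. The alternative \<open>t i = 0\<close> allows translating in selected
  directions only.\<close>

lemma axial_product_translate:
  assumes x: "x \<in> axial_product A d Y"
    and t: "\<And>i. i \<in> {1..d} \<Longrightarrow> t i = 0 \<or> shift ` Y i \<subseteq> Y i"
  shows "(\<lambda>g\<in>tuples d. x (\<lambda>j\<in>{1..d}. g j + t j)) \<in> axial_product A d Y" (is "?x \<in> _")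
proof -
  have mem: "(\<lambda>j\<in>{1..d}. g j + t j) \<in> tuples d" if "g \<in> tuples d" for g
    using that by (auto simp: tuples_def PiE_iff intro: trans_le_add1)
  have xc: "x \<in> configs A d" using x by (simp add: axial_product_def)
  have "?x \<in> configs A d"
    unfolding configs_def
    by (intro restrict_PiE_iff[THEN iffD2] ballI configs_app[OF xc] mem)
  moreover have "(\<lambda>m\<in>{1..}. ?x (g(i := m))) \<in> Y i"
    if i: "i \<in> {1..d}" and g: "g \<in> tuples d" and gi: "g i = 1" for i g
  proof -
    \<comment> \<open>Lines of \<open>x\<close> are constrained from base points with
      \<open>i\<close>-th coordinate 1, so the translated point is reset there; the lost
      \<open>t i\<close> steps are recovered by shifting.\<close>
    define g' where "g' = (\<lambda>j\<in>{1..d}. g j + t j)(i := 1)"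
    have g': "g' \<in> tuples d" unfolding g'_def by (rule tuples_upd[OF mem[OF g] i]) simp
    let ?l = "\<lambda>m\<in>{1..}. x (g'(i := m))"
    have l: "?l \<in> Y i" by (rule axial_productD[OF x i g']) (simp add: g'_def)
    have pow: "(shift ^^ s) y \<in> Y i" if "shift ` Y i \<subseteq> Y i" "y \<in> Y i" for s y
      using that by (induction s) auto
    have "(shift ^^ t i) ?l \<in> Y i" using t[OF i] pow l by auto
    also have "(shift ^^ t i) ?l = (\<lambda>m\<in>{1..}. x (g'(i := m + t i)))"
      by (rule shift_funpow)
    also have "\<dots> = (\<lambda>m\<in>{1..}. ?x (g(i := m)))"
    proof (rule restrict_ext)
      fix m :: nat assume m: "m \<in> {1..}"
      have "g(i := m) \<in> tuples d" using tuples_upd[OF g i] m by simp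
      moreover have "(\<lambda>j\<in>{1..d}. (g(i := m)) j + t j) = g'(i := m + t i)"
        using i by (auto simp: g'_def fun_eq_iff)
      ultimately show "x (g'(i := m + t i)) = ?x (g(i := m))" by simp
    qed
    finally show ?thesis .
  qed
  ultimately show ?thesis by (auto simp: axial_product_def)
qed

text \<open>The pattern of \<open>x\<close> on \<open>B\<close> can be read off from the patterns
  that its translates by elements of \<open>T\<close> show on \<open>B'\<close>. By invariance these
  lie in \<open>patterns B' W\<close>, which bounds the choices for each element of
  \<open>T\<close>.\<close>

lemma card_patterns_translates:
  assumes W: "W \<subseteq> configs A d" and A: "finite A" and T: "finite T"
    and inv: "\<And>t x. t \<in> T \<Longrightarrow> x \<in> W \<Longrightarrow> (\<lambda>g\<in>tuples d. x (\<lambda>j\<in>{1..d}. g j + t j)) \<in> W"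
    and B': "B' \<subseteq> tuples d" "finite B'"
    and cover: "B \<subseteq> (\<Union>t\<in>T. (\<lambda>g. \<lambda>j\<in>{1..d}. g j + t j) ` B')"
  shows "card (patterns B W) \<le> card (patterns B' W) ^ card T"
proof -
  define \<phi> where "\<phi> x = (\<lambda>t\<in>T. \<lambda>g\<in>B'. x (\<lambda>j\<in>{1..d}. g j + t j))" for x :: "(nat \<Rightarrow> nat) \<Rightarrow> 'a"
  have fin: "finite (T \<rightarrow>\<^sub>E patterns B' W)"
    by (intro finite_PiE T finite_patterns[OF W A B'])
  have sub: "\<phi> ` W \<subseteq> (T \<rightarrow>\<^sub>E patterns B' W)"
    unfolding \<phi>_def
  proof (intro image_subsetI restrict_PiE_iff[THEN iffD2] ballI)
    fix x t assume "x \<in> W" "t \<in> T"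
    from inv[OF this(2,1)]
    have "restrict (\<lambda>g\<in>tuples d. x (\<lambda>j\<in>{1..d}. g j + t j)) B' \<in> patterns B' W"
      unfolding patterns_def by (rule imageI)
    also have "restrict (\<lambda>g\<in>tuples d. x (\<lambda>j\<in>{1..d}. g j + t j)) B'
        = (\<lambda>g\<in>B'. x (\<lambda>j\<in>{1..d}. g j + t j))"
      using B'(1) by (subst restrict_restrict) (simp add: Int_absorb1)
    finally show "(\<lambda>g\<in>B'. x (\<lambda>j\<in>{1..d}. g j + t j)) \<in> patterns B' W" .
  qed
  have "card (patterns B W) \<le> card (\<phi> ` W)"
    unfolding patterns_def
  proof (rule card_image_le_via[OF _ finite_subset[OF sub fin]])
    fix x y assume eq: "\<phi> x = \<phi> y"
    show "restrict x B = restrict y B"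
    proof (rule restrict_ext)
      fix g assume "g \<in> B"
      then obtain t h where th: "t \<in> T" "h \<in> B'" "g = (\<lambda>j\<in>{1..d}. h j + t j)"
        using cover by blast
      have "\<phi> x t h = \<phi> y t h" using eq by simp
      then show "x g = y g" using th by (simp add: \<phi>_def)
    qed
  qed
  also have "\<dots> \<le> card (T \<rightarrow>\<^sub>E patterns B' W)" by (rule card_mono[OF fin sub])
  also have "\<dots> = card (patterns B' W) ^ card T" using T by (simp add: card_PiE)
  finally show ?thesis .
qed

text \<open>The box with sides \<open>n\<close> is covered by copies of the box with sides
  \<open>N\<close>, moved by multiples of \<open>N j\<close> in the directions of \<open>J\<close>.
  Copies may overhang, so \<open>n j div N j + 1\<close> of them suffice in direction
  \<open>j\<close>.\<close>

lemma card_patterns_int_box_le_power: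
  assumes A: "finite A" and J: "J \<subseteq> {1..d}"
    and sh: "\<And>j. j \<in> J \<Longrightarrow> shift ` Y j \<subseteq> Y j"
    and eq: "\<And>j. j \<in> {1..d} - J \<Longrightarrow> n j = N j"
    and N: "\<And>j. j \<in> J \<Longrightarrow> 1 \<le> N j"
  shows "card (patterns (int_box d n) (axial_product A d Y))
    \<le> card (patterns (int_box d N) (axial_product A d Y)) ^ (\<Prod>j\<in>J. n j div N j + 1)"
proof -
  define C where "C j = (if j \<in> J then (\<lambda>c. c * N j) ` {0..n j div N j} else {0})" for j
  define T where "T = (\<Pi>\<^sub>E j\<in>{1..d}. C j)"
  have finC: "finite (C j)" for j by (simp add: C_def)
  have finT: "finite T" unfolding T_def by (intro finite_PiE finC) simp
  have cardC: "card (C j) = (if j \<in> J then n j div N j + 1 else 1)" for j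
  proof (cases "j \<in> J")
    case True
    then have "inj_on (\<lambda>c. c * N j) {0..n j div N j}" using N by (force simp: inj_on_def)
    then show ?thesis using True by (simp add: C_def card_image)
  qed (simp add: C_def)
  have cardT: "card T = (\<Prod>j\<in>J. n j div N j + 1)"
  proof -
    have "card T = (\<Prod>j\<in>{1..d}. if j \<in> J then n j div N j + 1 else 1)"
      unfolding T_def by (simp add: card_PiE cardC)
    also have "\<dots> = (\<Prod>j\<in>{1..d} \<inter> J. n j div N j + 1)"
      by (subst prod.inter_restrict) auto
    also have "{1..d} \<inter> J = J" using J by auto
    finally show ?thesis .
  qed
  show ?thesis
    unfolding cardT[symmetric]
  proof (rule card_patterns_translates[OF axial_product_subset_configs A finT _
        int_box_subset_tuples finite_int_box])
    fix t x assume "t \<in> T" "x \<in> axial_product A d Y"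
    then show "(\<lambda>g\<in>tuples d. x (\<lambda>j\<in>{1..d}. g j + t j)) \<in> axial_product A d Y"
    proof (intro axial_product_translate)
      fix i assume i: "i \<in> {1..d}"
      then have "t i \<in> C i" using \<open>t \<in> T\<close> by (auto simp: T_def)
      then show "t i = 0 \<or> shift ` Y i \<subseteq> Y i"
        using sh[of i] by (cases "i \<in> J") (auto simp: C_def)
    qed
  next
    show "int_box d n \<subseteq> (\<Union>t\<in>T. (\<lambda>g. \<lambda>j\<in>{1..d}. g j + t j) ` int_box d N)"
    proof
      fix g assume g: "g \<in> int_box d n"
      \<comment> \<open>Coordinates start at 1, so \<open>g j - 1\<close> is divided by
        \<open>N j\<close>: the quotient selects the copy, the remainder plus 1 the place inside
        it.\<close>
      define t where "t = (\<lambda>j\<in>{1..d}. if j \<in> J then (g j - 1) div N j * N j else 0)"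
      define h where "h = (\<lambda>j\<in>{1..d}. if j \<in> J then (g j - 1) mod N j + 1 else g j)"
      have gj: "1 \<le> g j" "g j \<le> n j" if "j \<in> {1..d}" for j
        using g that by (auto simp: int_box_def)
      have "t \<in> T"
        unfolding T_def t_def C_def using gj
        by (auto simp: PiE_iff intro!: imageI div_le_mono order.trans[OF diff_le_self])
      moreover have "h \<in> int_box d N"
        unfolding int_box_def h_def
      proof (intro restrict_PiE_iff[THEN iffD2] ballI)
        fix j assume j: "j \<in> {1..d}"
        show "(if j \<in> J then (g j - 1) mod N j + 1 else g j) \<in> {1..N j}"
          using N[of j] gj[OF j] eq[of j] j mod_less_divisor[of "N j" "g j - 1"]
          by (auto simp: Suc_le_eq)
      qed
      moreover have "g = (\<lambda>j\<in>{1..d}. h j + t j)"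
      proof
        fix j
        show "g j = (\<lambda>j\<in>{1..d}. h j + t j) j"
        proof (cases "j \<in> {1..d}")
          case True
          have "(g j - 1) mod N j + 1 + (g j - 1) div N j * N j = g j"
            using gj(1)[OF True] mod_div_mult_eq[of "g j - 1" "N j"] by linarith
          then have "(if j \<in> J then (g j - 1) mod N j + 1 else g j)
              + (if j \<in> J then (g j - 1) div N j * N j else 0) = g j"
            by (cases "j \<in> J") (simp_all only: if_True if_False add_0_right)
          then have "h j + t j = g j" unfolding h_def t_def restrict_apply'[OF True] .
          then show ?thesis unfolding restrict_apply'[OF True] by (rule sym)
        next
          case False
          then show ?thesis using PiE_arb[OF g[unfolded int_box_def] False]
            by (simp only: restrict_apply if_False)
        qed
      qed
      ultimately show "g \<in> (\<Union>t\<in>T. (\<lambda>g. \<lambda>j\<in>{1..d}. g j + t j) ` int_box d N)"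
        by (intro UN_I image_eqI)
    qed
  qed
qed

section \<open>Logarithmic pattern counts and their subadditivity\<close>

definition log_card :: "nat \<Rightarrow> ((nat \<Rightarrow> nat) \<Rightarrow> 'a) set \<Rightarrow> (nat \<Rightarrow> nat) \<Rightarrow> real" where
  "log_card d W n = ln (real (card (patterns (int_box d n) W)))"

lemma log_card_nonneg: "0 \<le> log_card d W n"
  by (cases "card (patterns (int_box d n) W)") (auto simp: log_card_def)

lemma ln_card_le_power:
  fixes a b m :: nat
  assumes "a \<le> b ^ m" "b = 0 \<Longrightarrow> a = 0"
  shows "ln (real a) \<le> real m * ln (real b)"
proof (cases "a = 0")
  case True
  have "0 \<le> ln (real b)" by (cases b) auto
  then show ?thesis using True by simp
next
  case False
  then have b: "b > 0" using assms(2) by auto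
  have "ln (real a) \<le> ln (real (b ^ m))" using False assms(1) b by (subst ln_le_cancel_iff) auto
  then show ?thesis using b by (simp add: ln_realpow)
qed

lemma log_card_subadditive:
  assumes A: "finite A" and J: "J \<subseteq> {1..d}"
    and sh: "\<And>j. j \<in> J \<Longrightarrow> shift ` Y j \<subseteq> Y j"
    and eq: "\<And>j. j \<in> {1..d} - J \<Longrightarrow> n j = N j"
    and N: "\<And>j. j \<in> J \<Longrightarrow> 1 \<le> N j"
  shows "log_card d (axial_product A d Y) n
    \<le> (\<Prod>j\<in>J. real (n j) / real (N j) + 1) * log_card d (axial_product A d Y) N"
proof -
  let ?W = "axial_product A d Y"
  have fin: "finite (patterns (int_box d M) ?W)" for M
    by (rule finite_patterns[OF axial_product_subset_configs A int_box_subset_tuples finite_int_box])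
  have "log_card d ?W n \<le> real (\<Prod>j\<in>J. n j div N j + 1) * log_card d ?W N"
    unfolding log_card_def
  proof (rule ln_card_le_power[OF card_patterns_int_box_le_power[OF A J sh eq N]])
    \<comment> \<open>A nonempty \<open>?W\<close> has a pattern on every box, so a zero count
      forces \<open>?W\<close> to be empty.\<close>
    assume "card (patterns (int_box d N) ?W) = 0"
    then have "?W = {}" using fin by (simp add: patterns_def)
    then show "card (patterns (int_box d n) ?W) = 0" by (simp add: patterns_def)
  qed
  also have "\<dots> \<le> (\<Prod>j\<in>J. real (n j) / real (N j) + 1) * log_card d ?W N"
  proof (rule mult_right_mono[OF _ log_card_nonneg])
    have "(\<Prod>j\<in>J. real (n j div N j) + 1) \<le> (\<Prod>j\<in>J. real (n j) / real (N j) + 1)"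
      by (intro prod_mono conjI add_right_mono of_nat_div_le_of_nat) simp
    then show "real (\<Prod>j\<in>J. n j div N j + 1) \<le> (\<Prod>j\<in>J. real (n j) / real (N j) + 1)"
      by (simp add: add.commute)
  qed
  finally show ?thesis .
qed

lemma log_card_le:
  assumes W: "W \<subseteq> configs A d" and A: "finite A"
  shows "log_card d W n \<le> (\<Prod>j\<in>{1..d}. real (n j)) * ln (real (card A))"
proof -
  have "log_card d W n \<le> real (card (int_box d n)) * ln (real (card A))"
    unfolding log_card_def
  proof (rule ln_card_le_power[OF card_patterns_le[OF W A int_box_subset_tuples finite_int_box]])
    \<comment> \<open>Over an empty alphabet there is no configuration, because
      \<open>tuples d\<close> is nonempty. This covers boxes of volume 0 as well, where the bound
      \<open>card A ^ 0\<close> is 1.\<close>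
    assume "card A = 0"
    then have "A = {}" using A by simp
    moreover have "(\<lambda>j\<in>{1..d}. 1) \<in> tuples d" by (simp add: tuples_def)
    ultimately have "W = {}" using W configs_app[of _ A d] by blast
    then show "card (patterns (int_box d n) W) = 0" by (simp add: patterns_def)
  qed
  then show ?thesis by (simp add: card_int_box)
qed

section \<open>Limits with several coordinates tending to infinity\<close>

lemma eventually_coords_at_top:
  "eventually P (coords_at_top J) \<longleftrightarrow> (\<exists>N. \<forall>n. (\<forall>j\<in>J. N \<le> n j) \<longrightarrow> P n)"
  unfolding coords_at_top_def
proof (subst eventually_INF_base)
  fix a b :: nat
  show "\<exists>x\<in>UNIV. principal {n. \<forall>j\<in>J. x \<le> n j}
      \<le> inf (principal {n. \<forall>j\<in>J. a \<le> n j}) (principal {n. \<forall>j\<in>J. b \<le> n j})"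
    by (rule bexI[of _ "max a b"]) auto
qed (auto simp: eventually_principal)

text \<open>Properness makes limits along this filter unique, so that \<open>Lim\<close> returns the
  limit once it exists. Constant tuples lie beyond every threshold.\<close>

lemma coords_at_top_neq_bot: "coords_at_top J \<noteq> bot"
  unfolding trivial_limit_def eventually_coords_at_top by (auto intro!: exI[of _ "\<lambda>_. _"])

lemma filterlim_coord_at_top: "j \<in> J \<Longrightarrow> filterlim (\<lambda>n. n j) at_top (coords_at_top J)"
  unfolding filterlim_at_top eventually_coords_at_top by blast

text \<open>The entropy is taken along cubes, so the limits in several variables enter it only along
  the diagonal.\<close>

lemma filterlim_diag_coords_at_top: "filterlim (\<lambda>n _. n) (coords_at_top J) sequentially"
  unfolding filterlim_iff eventually_coords_at_top eventually_sequentially by metis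

text \<open>Fekete's lemma in several variables: the limit is the infimum of the normalized values.\<close>

lemma fekete_coords_at_top:
  fixes f :: "(nat \<Rightarrow> nat) \<Rightarrow> real"
  assumes J: "finite J" and f: "\<And>n. 0 \<le> f n"
    and sub: "\<And>n N. (\<And>j. j \<in> J \<Longrightarrow> 1 \<le> N j) \<Longrightarrow>
      f n \<le> (\<Prod>j\<in>J. real (n j) / real (N j) + 1) * f N"
  shows "\<exists>L. ((\<lambda>n. f n / (\<Prod>j\<in>J. real (n j))) \<longlongrightarrow> L) (coords_at_top J)"
proof -
  \<comment> \<open>The infimum is restricted to positive sides: a zero side in \<open>J\<close>
    would give \<open>u\<close> the default value 0 of division by zero.\<close>
  define P where "P = {N :: nat \<Rightarrow> nat. \<forall>j\<in>J. 1 \<le> N j}"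
  define u where "u n = f n / (\<Prod>j\<in>J. real (n j))" for n
  define L where "L = (INF N\<in>P. u N)"
  have u0: "0 \<le> u n" for n unfolding u_def by (intro divide_nonneg_nonneg f prod_nonneg) auto
  have P1: "(\<lambda>_. 1) \<in> P" by (simp add: P_def)
  have bdd: "bdd_below (u ` P)" using u0 by (auto intro!: bdd_belowI[of _ 0])
  have ev: "\<forall>\<^sub>F n in coords_at_top J. n \<in> P"
    unfolding eventually_coords_at_top P_def by blast
  have "(u \<longlongrightarrow> L) (coords_at_top J)"
  proof (rule order_tendstoI)
    fix a assume a: "a < L"
    show "\<forall>\<^sub>F n in coords_at_top J. a < u n"
      using ev
    proof eventually_elim
      case (elim n)
      then have "L \<le> u n" unfolding L_def by (rule cINF_lower[OF bdd])
      then show ?case using a by simp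
    qed
  next
    fix a assume "L < a"
    then obtain N where N: "N \<in> P" "u N < a"
      unfolding L_def using P1 by (subst (asm) cINF_less_iff[OF _ bdd]) auto
    \<comment> \<open>With \<open>N\<close> fixed, the bound from \<open>sub\<close> divided by the
      volume of \<open>n\<close> converges to \<open>u N\<close>, which is below
      \<open>a\<close>.\<close>
    have "((\<lambda>n. (\<Prod>j\<in>J. 1 / real (N j) + inverse (real (n j))) * f N)
        \<longlongrightarrow> (\<Prod>j\<in>J. 1 / real (N j) + 0) * f N) (coords_at_top J)"
      by (intro tendsto_mult tendsto_prod tendsto_add tendsto_const tendsto_inverse_0_at_top
          filterlim_compose[OF filterlim_real_sequentially] filterlim_coord_at_top)
    moreover have "(\<Prod>j\<in>J. 1 / real (N j) + 0) * f N = u N"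
      by (simp add: u_def prod_dividef)
    ultimately have "\<forall>\<^sub>F n in coords_at_top J.
        (\<Prod>j\<in>J. 1 / real (N j) + inverse (real (n j))) * f N < a"
      by (intro order_tendstoD(2)) (use N(2) in simp_all)
    then show "\<forall>\<^sub>F n in coords_at_top J. u n < a"
      using ev
    proof eventually_elim
      case (elim n)
      then have n: "real (n j) > 0" if "j \<in> J" for j using that by (force simp: P_def)
      have "u n \<le> (\<Prod>j\<in>J. real (n j) / real (N j) + 1) * f N / (\<Prod>j\<in>J. real (n j))"
        unfolding u_def
        by (intro divide_right_mono sub prod_nonneg) (use N in \<open>auto simp: P_def\<close>)
      also have "\<dots> = (\<Prod>j\<in>J. (real (n j) / real (N j) + 1) / real (n j)) * f N"
        by (simp add: prod_dividef)
      also have "(\<Prod>j\<in>J. (real (n j) / real (N j) + 1) / real (n j))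
          = (\<Prod>j\<in>J. 1 / real (N j) + inverse (real (n j)))"
      proof (rule prod.cong[OF refl])
        fix j assume "j \<in> J"
        then show "(real (n j) / real (N j) + 1) / real (n j) = 1 / real (N j) + inverse (real (n j))"
          using n[of j] by (simp add: add_divide_distrib inverse_eq_divide)
      qed
      finally show ?case using elim by linarith
    qed
  qed
  then show ?thesis unfolding u_def by blast
qed

lemma lambda_net_eq:
  "lambda_net d k W i n =
    log_card d W (\<lambda>j. if j \<le> k then i j else n j) / (\<Prod>j\<in>{k+1..d}. real (n j))"
  by (simp add: lambda_net_def log_card_def)

text \<open>With \<open>i\<close> frozen, the logarithmic count is subadditive in the remaining
  sides, because only the directions \<open>j > k\<close> are translated. This is what the Fekete
  lemma asks for.\<close>

lemma lambda_net_converges: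
  assumes A: "finite A" and k: "k \<le> d"
    and sh: "\<And>j. j \<in> {k+1..d} \<Longrightarrow> shift ` Y j \<subseteq> Y j"
  shows "\<exists>L. (lambda_net d k (axial_product A d Y) i \<longlongrightarrow> L) (coords_at_top {k+1..d})"
  unfolding lambda_net_eq[abs_def]
proof (rule fekete_coords_at_top)
  fix n N :: "nat \<Rightarrow> nat" assume N: "\<And>j. j \<in> {k+1..d} \<Longrightarrow> 1 \<le> N j"
  have "log_card d (axial_product A d Y) (\<lambda>j. if j \<le> k then i j else n j)
      \<le> (\<Prod>j\<in>{k+1..d}. real (if j \<le> k then i j else n j) / real (if j \<le> k then i j else N j) + 1)
        * log_card d (axial_product A d Y) (\<lambda>j. if j \<le> k then i j else N j)"
    by (rule log_card_subadditive[OF A _ sh]) (use N in auto)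
  also have "(\<Prod>j\<in>{k+1..d}. real (if j \<le> k then i j else n j) / real (if j \<le> k then i j else N j) + 1)
      = (\<Prod>j\<in>{k+1..d}. real (n j) / real (N j) + 1)"
    by (intro prod.cong) auto
  finally show "log_card d (axial_product A d Y) (\<lambda>j. if j \<le> k then i j else n j)
      \<le> (\<Prod>j\<in>{k+1..d}. real (n j) / real (N j) + 1)
        * log_card d (axial_product A d Y) (\<lambda>j. if j \<le> k then i j else N j)" .
qed (auto intro: log_card_nonneg)

section \<open>Orbit decomposition\<close>

definition nonmultiples :: "nat \<Rightarrow> (nat \<Rightarrow> nat) \<Rightarrow> (nat \<Rightarrow> nat) set" where
  "nonmultiples k p = (\<Pi>\<^sub>E j\<in>{1..k}. {q. 1 \<le> q \<and> \<not> p j dvd q})"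

text \<open>
  The tuples \<open>dilate d k p q h\<close>, \<open>h \<in> tuples d\<close>, form the orbit of \<open>q\<close> under multiplication of
  the \<open>j\<close>-th coordinate by \<open>p j\<close>, \<open>j \<le> k\<close>, together with all values of the other coordinates.
\<close>

definition dilate ::
    "nat \<Rightarrow> nat \<Rightarrow> (nat \<Rightarrow> nat) \<Rightarrow> (nat \<Rightarrow> nat) \<Rightarrow> (nat \<Rightarrow> nat) \<Rightarrow> nat \<Rightarrow> nat" where
  "dilate d k p q h = (\<lambda>j\<in>{1..d}. if j \<le> k then q j * p j ^ (h j - 1) else h j)"

text \<open>The base \<open>p\<close> may be composite: if \<open>p\<close> does not divide
  \<open>c\<close>, then \<open>multiplicity p (c * p ^ e)\<close> is still \<open>e\<close>, since
  \<open>p ^ e\<close> cancels.\<close>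

lemma mult_power_unique:
  fixes p q r :: nat
  assumes "q * p ^ a = r * p ^ b" "\<not> p dvd q" "\<not> p dvd r" "2 \<le> p"
  shows "q = r \<and> a = b"
proof -
  have mult: "multiplicity p (c * p ^ e) = e" if "\<not> p dvd c" for c e
    using that assms(4) by (intro multiplicity_eqI) auto
  have "a = b" using arg_cong[OF assms(1), of "multiplicity p"] assms(2,3) by (simp add: mult)
  then show ?thesis using assms by simp
qed

lemma mult_power_exists:
  fixes p n :: nat
  assumes "2 \<le> p" "1 \<le> n"
  obtains q a where "n = q * p ^ a" "\<not> p dvd q" "1 \<le> q"
proof -
  obtain y where y: "n = p ^ multiplicity p n * y" "\<not> p dvd y"
    by (rule multiplicity_decompose'[of n p]) (use assms in auto)
  with assms that[of y "multiplicity p n"] show ?thesis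
    by (cases "y = 0") (auto simp: mult.commute)
qed

lemma nonmultiplesD:
  assumes "q \<in> nonmultiples k p" "j \<in> {1..k}"
  shows "1 \<le> q j" "\<not> p j dvd q j"
  using assms by (auto simp: nonmultiples_def PiE_iff)

lemma tuplesD: "g \<in> tuples d \<Longrightarrow> j \<in> {1..d} \<Longrightarrow> 1 \<le> g j"
  by (auto simp: tuples_def PiE_iff)

lemma dilate_apply:
  "j \<in> {1..d} \<Longrightarrow> dilate d k p q h j = (if j \<le> k then q j * p j ^ (h j - 1) else h j)"
  by (simp add: dilate_def)

text \<open>For \<open>p \<ge> 2\<close> and \<open>q \<ge> 1\<close> the chain
  \<open>q, q * p, q * p ^ 2, \<dots>\<close> increases, so the first exponent that leaves
  \<open>{1..n}\<close> is also the number of its elements in \<open>{1..n}\<close>.\<close>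

definition chain_length :: "nat \<Rightarrow> nat \<Rightarrow> nat \<Rightarrow> nat" where
  "chain_length p n q = (LEAST l. n < q * p ^ l)"

lemma less_chain_length_iff:
  assumes "2 \<le> p" "1 \<le> q"
  shows "l < chain_length p n q \<longleftrightarrow> q * p ^ l \<le> n"
proof
  assume "l < chain_length p n q"
  then show "q * p ^ l \<le> n" unfolding chain_length_def by (auto dest: not_less_Least)
next
  assume le: "q * p ^ l \<le> n"
  \<comment> \<open>The exponent \<open>n\<close> witnesses that the \<open>LEAST\<close> is
    attained.\<close>
  have "n < q * p ^ n"
  proof -
    have "n < p ^ n" using assms(1) by (intro power_gt_expt) auto
    also have "\<dots> \<le> q * p ^ n" using assms(2) by simp
    finally show ?thesis .
  qed
  then have *: "n < q * p ^ chain_length p n q" unfolding chain_length_def by (rule LeastI)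
  show "l < chain_length p n q"
  proof (rule ccontr)
    assume "\<not> l < chain_length p n q"
    then have "q * p ^ chain_length p n q \<le> q * p ^ l"
      using assms by (intro mult_left_mono power_increasing) auto
    then show False using * le by linarith
  qed
qed


definition chain_starts :: "nat \<Rightarrow> (nat \<Rightarrow> nat) \<Rightarrow> nat \<Rightarrow> (nat \<Rightarrow> nat) set" where
  "chain_starts k p n = (\<Pi>\<^sub>E j\<in>{1..k}. {q \<in> {1..n}. \<not> p j dvd q})"

lemma finite_chain_starts: "finite (chain_starts k p n)"
  unfolding chain_starts_def by (intro finite_PiE) auto

lemma chain_starts_subset: "chain_starts k p n \<subseteq> nonmultiples k p"
  unfolding chain_starts_def nonmultiples_def by (intro PiE_mono) auto

text \<open>Restricted to \<open>{1..k}\<close> so that the values can be compared with elements of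
  \<open>tuples k\<close>.\<close>

definition chain_lengths :: "nat \<Rightarrow> (nat \<Rightarrow> nat) \<Rightarrow> nat \<Rightarrow> (nat \<Rightarrow> nat) \<Rightarrow> nat \<Rightarrow> nat" where
  "chain_lengths k p n q = (\<lambda>j\<in>{1..k}. chain_length (p j) n (q j))"

section \<open>Bijection with the orbits and factorization of pattern counts\<close>

context
  fixes d k :: nat and p :: "nat \<Rightarrow> nat"
  assumes k: "k \<le> d" and p: "\<And>j. j \<in> {1..k} \<Longrightarrow> 2 \<le> p j"
begin

lemma dilate_in_tuples:
  assumes q: "q \<in> nonmultiples k p" and h: "h \<in> tuples d"
  shows "dilate d k p q h \<in> tuples d"
  unfolding tuples_def dilate_def
proof (intro restrict_PiE_iff[THEN iffD2] ballI)
  fix j assume j: "j \<in> {1..d}"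
  show "(if j \<le> k then q j * p j ^ (h j - 1) else h j) \<in> {1..}"
    using nonmultiplesD[OF q, of j] tuplesD[OF h j] p[of j] j by (auto simp: Suc_le_eq)
qed

lemma dilate_surj:
  assumes g: "g \<in> tuples d"
  obtains q h where "q \<in> nonmultiples k p" "h \<in> tuples d" "g = dilate d k p q h"
proof -
  have "\<forall>j\<in>{1..k}. \<exists>q a. g j = q * p j ^ a \<and> \<not> p j dvd q \<and> 1 \<le> q"
  proof
    fix j assume j: "j \<in> {1..k}"
    then have "1 \<le> g j" using k by (intro tuplesD[OF g]) auto
    from mult_power_exists[OF p[OF j] this] show "\<exists>q a. g j = q * p j ^ a \<and> \<not> p j dvd q \<and> 1 \<le> q"
      by metis
  qed
  then obtain Q a where Q: "\<And>j. j \<in> {1..k} \<Longrightarrow> g j = Q j * p j ^ a j \<and> \<not> p j dvd Q j \<and> 1 \<le> Q j"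
    by metis
  define q where "q = restrict Q {1..k}"
  \<comment> \<open>Exponents start at 0 but coordinates at 1, hence \<open>a j + 1\<close>.\<close>
  define h where "h = (\<lambda>j\<in>{1..d}. if j \<le> k then a j + 1 else g j)"
  have "q \<in> nonmultiples k p" using Q by (auto simp: q_def nonmultiples_def)
  moreover have "h \<in> tuples d"
    unfolding h_def tuples_def using tuplesD[OF g]
    by (intro restrict_PiE_iff[THEN iffD2] ballI) auto
  moreover have "g = dilate d k p q h"
  proof
    fix j
    show "g j = dilate d k p q h j"
    proof (cases "j \<in> {1..d}")
      case True
      then show ?thesis using Q[of j] by (auto simp: dilate_def q_def h_def)
    next
      case False
      then show ?thesis using PiE_arb[OF g[unfolded tuples_def] False]
        by (simp only: dilate_def restrict_apply if_False)
    qed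
  qed
  ultimately show ?thesis by (rule that)
qed

text \<open>Unique factorization recovers \<open>q j\<close> and \<open>h j\<close> for
  \<open>j \<le> k\<close>; the remaining coordinates of \<open>h\<close> are copied unchanged. With
  \<open>dilate_surj\<close>, the orbits partition the lattice.\<close>

lemma dilate_inj:
  assumes q: "q \<in> nonmultiples k p" "q' \<in> nonmultiples k p" and h: "h \<in> tuples d" "h' \<in> tuples d"
    and eq: "dilate d k p q h = dilate d k p q' h'"
  shows "q = q'" "h = h'"
proof -
  have 1: "q j = q' j \<and> h j = h' j" if j: "j \<in> {1..k}" for j
  proof -
    have jd: "j \<in> {1..d}" using j k by auto
    have "q j * p j ^ (h j - 1) = q' j * p j ^ (h' j - 1)"
      using fun_cong[OF eq, of j] j jd by (simp add: dilate_apply)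
    from mult_power_unique[OF this nonmultiplesD(2)[OF q(1) j] nonmultiplesD(2)[OF q(2) j] p[OF j]]
    show ?thesis using tuplesD[OF h(1) jd] tuplesD[OF h(2) jd] by auto
  qed
  show "q = q'" using q 1 unfolding nonmultiples_def by (intro PiE_ext) auto
  have "h j = h' j" if j: "j \<in> {1..d}" for j
    using 1[of j] fun_cong[OF eq, of j] j by (cases "j \<le> k") (auto simp: dilate_apply)
  then show "h = h'" using h unfolding tuples_def by (intro PiE_ext)
qed

text \<open>An axial line in orbit coordinates stays on one axial line of the lattice: for
  \<open>i \<le> k\<close> it is a geometric progression there, otherwise the whole line.\<close>

lemma dilate_upd:
  assumes "i \<in> {1..d}"
  shows "dilate d k p q (h(i := m)) =
    (dilate d k p q h)(i := if i \<le> k then q i * p i ^ (m - 1) else m)"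
  using assms by (auto simp: dilate_def fun_eq_iff)

text \<open>In a direction \<open>i \<le> k\<close>, the lines of an orbit are the progressions with
  ratio \<open>p i\<close> and start \<open>q i\<close> on lines of \<open>x\<close>, which are the
  sequences that \<open>mult_subshift\<close> constrains. Every non-multiple of \<open>p i\<close>
  occurs as such a start.\<close>

lemma axial_product_mult_subshift_iff:
  fixes A :: "'a set"
  assumes x: "x \<in> configs A d"
  shows "x \<in> axial_product A d (\<lambda>i. if i \<le> k then mult_subshift A (p i) (Y i) else Y i) \<longleftrightarrow>
    (\<forall>q\<in>nonmultiples k p. (\<lambda>h\<in>tuples d. x (dilate d k p q h)) \<in> axial_product A d Y)"
    (is "x \<in> ?Z \<longleftrightarrow> (\<forall>q\<in>_. ?w q \<in> ?W)")
proof
  assume xZ: "x \<in> ?Z"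
  show "\<forall>q\<in>nonmultiples k p. ?w q \<in> ?W"
  proof
    fix q assume q: "q \<in> nonmultiples k p"
    have "?w q \<in> configs A d"
      unfolding configs_def
      by (intro restrict_PiE_iff[THEN iffD2] ballI configs_app[OF x] dilate_in_tuples[OF q])
    moreover have "(\<lambda>m\<in>{1..}. ?w q (h(i := m))) \<in> Y i"
      if i: "i \<in> {1..d}" and h: "h \<in> tuples d" and hi: "h i = 1" for i h
    proof -
      have line: "(\<lambda>m\<in>{1..}. ?w q (h(i := m))) =
          (\<lambda>m\<in>{1..}. x ((dilate d k p q h)(i := if i \<le> k then q i * p i ^ (m - 1) else m)))"
      proof (rule restrict_ext)
        fix m :: nat assume "m \<in> {1..}"
        then have "h(i := m) \<in> tuples d" using tuples_upd[OF h i] by simp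
        then show "?w q (h(i := m)) =
            x ((dilate d k p q h)(i := if i \<le> k then q i * p i ^ (m - 1) else m))"
          by (simp add: dilate_upd[OF i])
      qed
      show ?thesis
      proof (cases "i \<le> k")
        case False
        have "dilate d k p q h i = 1" using False i hi by (simp add: dilate_apply)
        from axial_productD[OF xZ i dilate_in_tuples[OF q h] this] show ?thesis
          unfolding line using False by simp
      next
        case True
        then have ik: "i \<in> {1..k}" using i by auto
        \<comment> \<open>The full line of \<open>x\<close> containing the orbit line, based at
          coordinate 1; evaluating it at \<open>q i * p i ^ (m - 1)\<close> gives the orbit line
          back.\<close>
        define g where "g = (dilate d k p q h)(i := 1)"
        have g: "g \<in> tuples d" "g i = 1"
          unfolding g_def by (auto intro!: tuples_upd dilate_in_tuples q h simp: i[simplified])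
        have "(\<lambda>m\<in>{1..}. x (g(i := m))) \<in> mult_subshift A (p i) (Y i)"
          using axial_productD[OF xZ i g] True by simp
        then have "(\<lambda>m\<in>{1..}. (\<lambda>m\<in>{1..}. x (g(i := m))) (q i * p i ^ (m - 1))) \<in> Y i"
          using nonmultiplesD[OF q ik] unfolding mult_subshift_def by blast
        also have "(\<lambda>m\<in>{1..}. (\<lambda>m\<in>{1..}. x (g(i := m))) (q i * p i ^ (m - 1))) =
            (\<lambda>m\<in>{1..}. x (g(i := q i * p i ^ (m - 1))))"
          using nonmultiplesD[OF q ik] p[OF ik] by (intro restrict_ext) (auto simp: Suc_le_eq)
        finally show ?thesis unfolding line g_def using True by (simp only: fun_upd_upd if_True)
      qed
    qed
    ultimately show "?w q \<in> ?W" by (auto simp: axial_product_def)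
  qed
next
  assume W: "\<forall>q\<in>nonmultiples k p. ?w q \<in> ?W"
  have line: "(\<lambda>m\<in>{1..}. x (dilate d k p q (h(i := m)))) \<in> Y i"
    if q: "q \<in> nonmultiples k p" and i: "i \<in> {1..d}" and h: "h \<in> tuples d" and hi: "h i = 1" for q h i
  proof -
    have "(\<lambda>m\<in>{1..}. ?w q (h(i := m))) \<in> Y i"
      using axial_productD[OF _ i h hi] W q by blast
    also have "(\<lambda>m\<in>{1..}. ?w q (h(i := m))) = (\<lambda>m\<in>{1..}. x (dilate d k p q (h(i := m))))"
      using tuples_upd[OF h i] by (intro restrict_ext) simp
    finally show ?thesis .
  qed
  have "(\<lambda>m\<in>{1..}. x (g(i := m))) \<in> (if i \<le> k then mult_subshift A (p i) (Y i) else Y i)"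
    if i: "i \<in> {1..d}" and g: "g \<in> tuples d" and gi: "g i = 1" for i g
  proof (cases "i \<le> k")
    case False
    obtain q h where qh: "q \<in> nonmultiples k p" "h \<in> tuples d" "g = dilate d k p q h"
      by (rule dilate_surj[OF g])
    have "h i = 1" using gi i False unfolding qh(3) by (simp add: dilate_apply)
    from line[OF qh(1) i qh(2) this] show ?thesis
      unfolding dilate_upd[OF i] using False by (simp add: qh(3))
  next
    case True
    then have ik: "i \<in> {1..k}" using i by auto
    let ?l = "\<lambda>m\<in>{1..}. x (g(i := m))"
    have "?l \<in> seqs A"
      unfolding seqs_def
      by (intro restrict_PiE_iff[THEN iffD2] ballI configs_app[OF x] tuples_upd[OF g i]) simp
    moreover have "(\<lambda>m\<in>{1..}. ?l (r * p i ^ (m - 1))) \<in> Y i" if r: "1 \<le> r" "\<not> p i dvd r" for r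
    proof -
      \<comment> \<open>The orbit through the point with \<open>i\<close>-th coordinate
        \<open>r\<close> is the one to use: since \<open>p i\<close> does not divide
        \<open>r\<close>, its start is \<open>q i = r\<close> and the point sits at
        \<open>h i = 1\<close>.\<close>
      obtain q h where qh: "q \<in> nonmultiples k p" "h \<in> tuples d" "g(i := r) = dilate d k p q h"
        by (rule dilate_surj[OF tuples_upd[OF g i r(1)]])
      have "r * p i ^ 0 = q i * p i ^ (h i - 1)"
        using fun_cong[OF qh(3), of i] True i by (simp add: dilate_apply)
      from mult_power_unique[OF this r(2) nonmultiplesD(2)[OF qh(1) ik] p[OF ik]]
      have qi: "q i = r" and hi: "h i = 1" using tuplesD[OF qh(2) i] by auto
      have "(\<lambda>m\<in>{1..}. ?l (r * p i ^ (m - 1))) = (\<lambda>m\<in>{1..}. x (dilate d k p q (h(i := m))))"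
      proof (rule restrict_ext)
        fix m :: nat
        have "dilate d k p q (h(i := m)) = g(i := r * p i ^ (m - 1))"
          unfolding dilate_upd[OF i] qh(3)[symmetric] using True by (simp add: qi)
        moreover have "1 \<le> r * p i ^ (m - 1)" using r p[OF ik] by (simp add: Suc_le_eq)
        ultimately show "?l (r * p i ^ (m - 1)) = x (dilate d k p q (h(i := m)))" by simp
      qed
      then show ?thesis using line[OF qh(1) i qh(2) hi] by simp
    qed
    ultimately show ?thesis using True by (auto simp: mult_subshift_def)
  qed
  then show "x \<in> ?Z" using x by (auto simp: axial_product_def)
qed

text \<open>For \<open>j \<le> k\<close> the bound on coordinate \<open>j\<close> says that the
  exponent \<open>h j - 1\<close> is below the chain length. It also forces
  \<open>q j \<le> n\<close>, which leaves finitely many orbits.\<close>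

lemma dilate_in_int_box_iff:
  assumes q: "q \<in> nonmultiples k p" and h: "h \<in> tuples d"
  shows "dilate d k p q h \<in> int_box d (\<lambda>_. n) \<longleftrightarrow>
    q \<in> chain_starts k p n \<and> h \<in> int_box d (\<lambda>j. if j \<le> k then chain_lengths k p n q j else n)"
proof -
  have low: "q j * p j ^ (h j - 1) \<le> n \<longleftrightarrow> q j \<le> n \<and> h j \<le> chain_lengths k p n q j"
    if j: "j \<in> {1..k}" for j
  proof -
    note q1 = nonmultiplesD(1)[OF q j]
    have h1: "1 \<le> h j" using j k by (intro tuplesD[OF h]) auto
    have "q j * p j ^ (h j - 1) \<le> n \<longleftrightarrow> h j \<le> chain_lengths k p n q j"
      using h1 j less_chain_length_iff[OF p[OF j] q1, of "h j - 1" n]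
      by (auto simp: chain_lengths_def)
    moreover have "q j \<le> q j * p j ^ (h j - 1)" using p[OF j] by simp
    ultimately show ?thesis by linarith
  qed
  have "dilate d k p q h \<in> int_box d (\<lambda>_. n) \<longleftrightarrow> (\<forall>j\<in>{1..d}. dilate d k p q h j \<le> n)"
    using dilate_in_tuples[OF q h] unfolding int_box_def tuples_def by (auto simp: PiE_iff)
  also have "\<dots> \<longleftrightarrow> (\<forall>j\<in>{1..d}.
      (j \<le> k \<longrightarrow> q j \<le> n) \<and> h j \<le> (if j \<le> k then chain_lengths k p n q j else n))"
  proof (rule ball_cong[OF refl])
    fix j assume "j \<in> {1..d}"
    then show "dilate d k p q h j \<le> n \<longleftrightarrow>
        (j \<le> k \<longrightarrow> q j \<le> n) \<and> h j \<le> (if j \<le> k then chain_lengths k p n q j else n)"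
      using low[of j] by (auto simp: dilate_apply)
  qed
  also have "\<dots> \<longleftrightarrow> (\<forall>j\<in>{1..k}. q j \<le> n) \<and>
      (\<forall>j\<in>{1..d}. h j \<le> (if j \<le> k then chain_lengths k p n q j else n))"
    using k by fastforce
  also have "(\<forall>j\<in>{1..k}. q j \<le> n) \<longleftrightarrow> q \<in> chain_starts k p n"
    using q by (auto simp: nonmultiples_def chain_starts_def PiE_iff)
  also have "(\<forall>j\<in>{1..d}. h j \<le> (if j \<le> k then chain_lengths k p n q j else n)) \<longleftrightarrow>
      h \<in> int_box d (\<lambda>j. if j \<le> k then chain_lengths k p n q j else n)"
    using h by (auto simp: tuples_def int_box_def PiE_iff)
  finally show ?thesis .
qed

text \<open>
  Each orbit carries its own, freely chosen configuration of the axial product of the \<open>Y i\<close>.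
\<close>

lemma card_patterns_mult_axial_product:
  fixes A :: "'a set"
  assumes A: "finite A"
  shows "card (patterns (int_box d (\<lambda>_. n))
      (axial_product A d (\<lambda>i. if i \<le> k then mult_subshift A (p i) (Y i) else Y i))) =
    (if axial_product A d Y = {} then 0 else
      (\<Prod>q\<in>chain_starts k p n. card (patterns
        (int_box d (\<lambda>j. if j \<le> k then chain_lengths k p n q j else n)) (axial_product A d Y))))"
proof -
  define Z where "Z = axial_product A d (\<lambda>i. if i \<le> k then mult_subshift A (p i) (Y i) else Y i)"
  define W where "W = axial_product A d Y"
  define Q where "Q = chain_starts k p n"
  define R where "R q = int_box d (\<lambda>j. if j \<le> k then chain_lengths k p n q j else n)" for q
  define B where "B = int_box d (\<lambda>_. n)"
  define w where "w x q = (\<lambda>h\<in>tuples d. x (dilate d k p q h))" for x :: "(nat \<Rightarrow> nat) \<Rightarrow> 'a" and q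
  \<comment> \<open>The pattern on the cube, cut into one box pattern per orbit; by
    \<open>\<Phi>_eq\<close> below it carries the same information as the pattern on
    \<open>B\<close>.\<close>
  define \<Phi> where "\<Phi> x = (\<lambda>q\<in>Q. restrict (w x q) (R q))" for x :: "(nat \<Rightarrow> nat) \<Rightarrow> 'a"
  have Zc: "Z \<subseteq> configs A d" and Wc: "W \<subseteq> configs A d"
    unfolding Z_def W_def by (rule axial_product_subset_configs)+
  have Z_iff: "x \<in> Z \<longleftrightarrow> (\<forall>q\<in>nonmultiples k p. w x q \<in> W)" if "x \<in> configs A d" for x
    unfolding Z_def W_def w_def by (rule axial_product_mult_subshift_iff[OF that])
  have Rt: "R q \<subseteq> tuples d" for q unfolding R_def by (rule int_box_subset_tuples)
  have QN: "Q \<subseteq> nonmultiples k p" unfolding Q_def by (rule chain_starts_subset)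
  have B_iff: "dilate d k p q h \<in> B \<longleftrightarrow> q \<in> Q \<and> h \<in> R q"
    if "q \<in> nonmultiples k p" "h \<in> tuples d" for q h
    unfolding B_def Q_def R_def by (rule dilate_in_int_box_iff[OF that])
  have \<Phi>_eq: "\<Phi> x = \<Phi> y \<longleftrightarrow> restrict x B = restrict y B" for x y
  proof
    assume eq: "\<Phi> x = \<Phi> y"
    show "restrict x B = restrict y B"
    proof (rule restrict_ext)
      fix g assume g: "g \<in> B"
      then have "g \<in> tuples d" using int_box_subset_tuples unfolding B_def by blast
      then obtain q h
        where qh: "q \<in> nonmultiples k p" "h \<in> tuples d" "g = dilate d k p q h"
        by (rule dilate_surj)
      then have mem: "q \<in> Q" "h \<in> R q" using B_iff g by auto
      have "\<Phi> x q h = \<Phi> y q h" using eq by simp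
      then show "x g = y g" using mem qh by (simp add: \<Phi>_def w_def)
    qed
  next
    assume eq: "restrict x B = restrict y B"
    show "\<Phi> x = \<Phi> y"
      unfolding \<Phi>_def
    proof (intro restrict_ext)
      fix q h assume qh: "q \<in> Q" "h \<in> R q"
      then have t: "q \<in> nonmultiples k p" "h \<in> tuples d" using QN Rt by auto
      then have "dilate d k p q h \<in> B" using B_iff qh by simp
      then have "x (dilate d k p q h) = y (dilate d k p q h)" using fun_cong[OF eq] by (metis restrict_apply')
      then show "w x q h = w y q h" using t by (simp add: w_def)
    qed
  qed
  have finPi: "finite (\<Pi>\<^sub>E q\<in>Q. patterns (R q) W)"
    unfolding Q_def R_def
    by (intro finite_PiE finite_chain_starts finite_patterns[OF Wc A] int_box_subset_tuples finite_int_box)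
  have img: "\<Phi> ` Z = (\<Pi>\<^sub>E q\<in>Q. patterns (R q) W)" if W: "W \<noteq> {}"
  proof
    show "\<Phi> ` Z \<subseteq> (\<Pi>\<^sub>E q\<in>Q. patterns (R q) W)"
    proof (rule image_subsetI)
      fix x assume "x \<in> Z"
      then have "w x q \<in> W" if "q \<in> Q" for q using Z_iff Zc QN that by blast
      then show "\<Phi> x \<in> (\<Pi>\<^sub>E q\<in>Q. patterns (R q) W)"
        by (auto simp: \<Phi>_def patterns_def)
    qed
  next
    show "(\<Pi>\<^sub>E q\<in>Q. patterns (R q) W) \<subseteq> \<Phi> ` Z"
    proof
      fix f assume f: "f \<in> (\<Pi>\<^sub>E q\<in>Q. patterns (R q) W)"
      \<comment> \<open>Orbits outside \<open>Q\<close> miss the cube but must be filled too; any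
        element of the nonempty \<open>W\<close> serves.\<close>
      have "\<forall>q. \<exists>v\<in>W. q \<in> Q \<longrightarrow> f q = restrict v (R q)"
      proof
        fix q
        show "\<exists>v\<in>W. q \<in> Q \<longrightarrow> f q = restrict v (R q)"
        proof (cases "q \<in> Q")
          case True
          from PiE_mem[OF f this] show ?thesis by (auto simp: patterns_def)
        qed (use W in auto)
      qed
      then obtain v where v: "\<And>q. v q \<in> W" "\<And>q. q \<in> Q \<Longrightarrow> f q = restrict (v q) (R q)"
        by metis
      have "\<forall>g\<in>tuples d. \<exists>qh. fst qh \<in> nonmultiples k p \<and> snd qh \<in> tuples d \<and>
          g = dilate d k p (fst qh) (snd qh)"
        using dilate_surj by (metis fst_conv snd_conv)
      then obtain D where D: "\<And>g. g \<in> tuples d \<Longrightarrow> fst (D g) \<in> nonmultiples k p \<and>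
          snd (D g) \<in> tuples d \<and> g = dilate d k p (fst (D g)) (snd (D g))"
        by metis
      \<comment> \<open>\<open>D\<close> inverts \<open>dilate\<close>, so the definition writes
        \<open>v q\<close> onto the orbit of \<open>q\<close>. Disjointness of the orbits makes
        these choices independent.\<close>
      define x where "x = (\<lambda>g\<in>tuples d. v (fst (D g)) (snd (D g)))"
      have xc: "x \<in> configs A d"
        unfolding configs_def x_def
      proof (intro restrict_PiE_iff[THEN iffD2] ballI)
        fix g assume "g \<in> tuples d"
        from D[OF this] show "v (fst (D g)) (snd (D g)) \<in> A"
          using configs_app[OF subsetD[OF Wc v(1)]] by blast
      qed
      have wx: "w x q = v q" if q: "q \<in> nonmultiples k p" for q
      proof -
        have "w x q = restrict (v q) (tuples d)"
          unfolding w_def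
        proof (rule restrict_ext)
          fix h assume h: "h \<in> tuples d"
          let ?g = "dilate d k p q h"
          have g: "?g \<in> tuples d" by (rule dilate_in_tuples[OF q h])
          have "fst (D ?g) = q" "snd (D ?g) = h"
            using D[OF g] dilate_inj[OF _ q _ h] by metis+
          then show "x ?g = v q h" using g by (simp add: x_def)
        qed
        also have "\<dots> = v q"
          using subsetD[OF Wc v(1)[of q]] unfolding configs_def by (rule PiE_restrict)
        finally show ?thesis .
      qed
      have "x \<in> Z" using Z_iff[OF xc] wx v(1) by simp
      moreover have "f = \<Phi> x"
      proof (rule PiE_ext[OF f])
        show "\<Phi> x \<in> (\<Pi>\<^sub>E q\<in>Q. patterns (R q) W)"
          using wx v(1) QN by (auto simp: \<Phi>_def patterns_def)
        show "f q = \<Phi> x q" if "q \<in> Q" for q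
          using that wx v(2) QN by (auto simp: \<Phi>_def)
      qed
      ultimately show "f \<in> \<Phi> ` Z" by blast
    qed
  qed
  have "card (patterns B Z) = (if W = {} then 0 else \<Prod>q\<in>Q. card (patterns (R q) W))"
  proof (cases "W = {}")
    case True
    \<comment> \<open>At least one orbit exists, so an empty \<open>W\<close> leaves no
      configuration in \<open>Z\<close>. The separate case matters when \<open>Q\<close> is empty,
      where the product would be 1.\<close>
    have "(\<lambda>j\<in>{1..k}. 1) \<in> nonmultiples k p"
      using p by (fastforce simp: nonmultiples_def)
    then have "Z = {}" using Z_iff Zc True by blast
    then show ?thesis using True by (simp add: patterns_def)
  next
    case False
    have fin: "finite (\<Phi> ` Z)" using finPi img[OF False] by simp
    have fin': "finite (patterns B Z)"
      unfolding B_def by (rule finite_patterns[OF Zc A int_box_subset_tuples finite_int_box])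
    have "card (patterns B Z) = card (\<Phi> ` Z)"
      unfolding patterns_def
      by (intro antisym card_image_le_via fin fin'[unfolded patterns_def]) (simp_all add: \<Phi>_eq)
    also have "\<dots> = (\<Prod>q\<in>Q. card (patterns (R q) W))"
      unfolding img[OF False] Q_def by (simp add: card_PiE finite_chain_starts)
    finally show ?thesis using False by simp
  qed
  then show ?thesis unfolding B_def Z_def W_def Q_def R_def .
qed

lemma log_card_mult_axial_product:
  fixes A :: "'a set"
  assumes A: "finite A"
  shows "log_card d (axial_product A d (\<lambda>i. if i \<le> k then mult_subshift A (p i) (Y i) else Y i)) (\<lambda>_. n) =
    (\<Sum>q\<in>chain_starts k p n. log_card d (axial_product A d Y)
      (\<lambda>j. if j \<le> k then chain_lengths k p n q j else n))"
proof (cases "axial_product A d Y = {}")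
  case True
  then show ?thesis
    unfolding log_card_def card_patterns_mult_axial_product[OF A] by (simp add: patterns_def)
next
  case False
  \<comment> \<open>Positive factors turn the logarithm of the product into a sum. In the empty case
    both sides vanish by \<open>ln 0 = 0\<close>.\<close>
  have "card (patterns (int_box d N) (axial_product A d Y)) > 0" for N
    using False finite_patterns[OF axial_product_subset_configs A int_box_subset_tuples finite_int_box]
    by (auto simp: card_gt_0_iff patterns_def)
  then show ?thesis
    using False
    by (simp add: log_card_def card_patterns_mult_axial_product[OF A] ln_prod finite_chain_starts)
qed

end

section \<open>Frequencies of orbit lengths\<close>

lemma card_nonmultiples_upto:
  fixes p N :: nat
  assumes "2 \<le> p"
  shows "real (card {q \<in> {1..N}. \<not> p dvd q}) = real N - real (N div p)"
proof -
  have mult: "{q \<in> {1..N}. p dvd q} = (\<lambda>c. p * c) ` {1..N div p}"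
  proof (intro equalityI subsetI)
    fix q assume q: "q \<in> {q \<in> {1..N}. p dvd q}"
    then obtain c where c: "q = p * c" by (auto elim: dvdE)
    then have "c \<le> N div p" "1 \<le> c"
      using q assms by (auto simp: less_eq_div_iff_mult_less_eq mult.commute Suc_le_eq)
    then show "q \<in> (\<lambda>c. p * c) ` {1..N div p}" using c by auto
  next
    fix q assume "q \<in> (\<lambda>c. p * c) ` {1..N div p}"
    then show "q \<in> {q \<in> {1..N}. p dvd q}"
      using assms by (auto simp: less_eq_div_iff_mult_less_eq mult.commute Suc_le_eq)
  qed
  have "{q \<in> {1..N}. \<not> p dvd q} = {1..N} - {q \<in> {1..N}. p dvd q}" by auto
  also have "card \<dots> = card {1..N} - card {q \<in> {1..N}. p dvd q}"
    by (rule card_Diff_subset) auto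
  also have "card {q \<in> {1..N}. p dvd q} = N div p"
    unfolding mult using assms by (subst card_image) (auto simp: inj_on_def)
  finally show ?thesis by (simp add: of_nat_diff)
qed

lemma tendsto_nat_div_over:
  assumes "1 \<le> m"
  shows "(\<lambda>n. real (n div m) / real n) \<longlonglongrightarrow> 1 / real m"
proof (rule tendsto_sandwich)
  have low: "real n / real m - 1 \<le> real (n div m)" for n
    using real_of_int_floor_gt_diff_one[of "real n / real m"]
    by (simp add: floor_divide_of_nat_eq)
  show "\<forall>\<^sub>F n in sequentially. 1 / real m - inverse (real n) \<le> real (n div m) / real n"
    using eventually_gt_at_top[of 0]
  proof eventually_elim
    case (elim n)
    have "1 / real m - inverse (real n) = (real n / real m - 1) / real n"
      using elim by (simp add: diff_divide_distrib inverse_eq_divide)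
    also have "\<dots> \<le> real (n div m) / real n" by (intro divide_right_mono low) simp
    finally show ?case .
  qed
  show "\<forall>\<^sub>F n in sequentially. real (n div m) / real n \<le> 1 / real m"
    using eventually_gt_at_top[of 0]
  proof eventually_elim
    case (elim n)
    have "real (n div m) / real n \<le> (real n / real m) / real n"
      by (intro divide_right_mono of_nat_div_le_of_nat) simp
    then show ?case using elim by simp
  qed
  have "(\<lambda>n. 1 / real m - inverse (real n)) \<longlonglongrightarrow> 1 / real m - 0"
    by (intro tendsto_diff tendsto_const lim_inverse_n)
  then show "(\<lambda>n. 1 / real m - inverse (real n)) \<longlonglongrightarrow> 1 / real m" by simp
qed simp

definition chain_count :: "nat \<Rightarrow> nat \<Rightarrow> nat \<Rightarrow> nat" where
  "chain_count p n i = card {q \<in> {1..n}. \<not> p dvd q \<and> chain_length p n q = i}"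

text \<open>A chain has length \<open>i\<close> iff its start lies above \<open>n div p ^ i\<close>
  and not above \<open>n div p ^ (i - 1)\<close>. Up to \<open>N\<close> there are
  \<open>N - N div p\<close> non-multiples; subtracting the two counts makes the middle term appear
  twice.\<close>

lemma chain_count_eq:
  assumes p: "2 \<le> p" and i: "1 \<le> i"
  shows "real (chain_count p n i) =
    real (n div p ^ (i - 1)) - 2 * real (n div p ^ i) + real (n div p ^ (i + 1))"
proof -
  define S where "S N = {q \<in> {1..N}. \<not> p dvd q}" for N
  have fin: "finite (S N)" for N by (simp add: S_def)
  have cardS: "real (card (S (n div p ^ a))) = real (n div p ^ a) - real (n div p ^ (a + 1))" for a
    unfolding S_def card_nonmultiples_upto[OF p] by (simp add: div_mult2_eq[symmetric] mult.commute)
  have "n div p ^ i \<le> n div p ^ (i - 1)"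
    by (intro div_le_mono2 power_increasing) (use p in auto)
  then have sub: "S (n div p ^ i) \<subseteq> S (n div p ^ (i - 1))" by (auto simp: S_def)
  have "{q \<in> {1..n}. \<not> p dvd q \<and> chain_length p n q = i} = S (n div p ^ (i - 1)) - S (n div p ^ i)"
  proof (rule set_eqI)
    fix q
    show "q \<in> {q \<in> {1..n}. \<not> p dvd q \<and> chain_length p n q = i} \<longleftrightarrow>
        q \<in> S (n div p ^ (i - 1)) - S (n div p ^ i)"
    proof (cases "1 \<le> q \<and> \<not> p dvd q")
      case True
      have le: "l < chain_length p n q \<longleftrightarrow> q \<le> n div p ^ l" for l
        using less_chain_length_iff[OF p, of q l n] True p
        by (simp add: less_eq_div_iff_mult_less_eq)
      have "chain_length p n q = i \<longleftrightarrow> i - 1 < chain_length p n q \<and> \<not> i < chain_length p n q"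
        using i by linarith
      moreover have "q \<le> n div p ^ (i - 1) \<Longrightarrow> q \<le> n"
        by (meson div_le_dividend order.trans)
      ultimately show ?thesis using True le by (auto simp: S_def)
    qed (auto simp: S_def)
  qed
  then have "chain_count p n i = card (S (n div p ^ (i - 1)) - S (n div p ^ i))"
    by (simp add: chain_count_def)
  also have "\<dots> = card (S (n div p ^ (i - 1))) - card (S (n div p ^ i))"
    by (rule card_Diff_subset[OF fin sub])
  finally have c: "chain_count p n i = card (S (n div p ^ (i - 1))) - card (S (n div p ^ i))" .
  have "real (chain_count p n i) = real (card (S (n div p ^ (i - 1)))) - real (card (S (n div p ^ i)))"
    unfolding c by (rule of_nat_diff[OF card_mono[OF fin sub]])
  then show ?thesis using i by (simp add: cardS)
qed

text \<open>A geometric bound uniform in \<open>n\<close>, needed to dominate the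
  frequencies.\<close>

lemma chain_count_le:
  assumes "2 \<le> p" "1 \<le> i"
  shows "real (chain_count p n i) / real n \<le> 1 / real p ^ (i - 1)"
proof -
  have "n div p ^ (i + 1) \<le> n div p ^ i"
    by (intro div_le_mono2 power_increasing) (use assms in auto)
  then have "real (chain_count p n i) \<le> real (n div p ^ (i - 1))"
    unfolding chain_count_eq[OF assms] by simp
  also have "\<dots> \<le> real n / real (p ^ (i - 1))" by (rule of_nat_div_le_of_nat)
  finally have "real (chain_count p n i) / real n \<le> real n / real (p ^ (i - 1)) / real n"
    by (rule divide_right_mono) simp
  also have "\<dots> \<le> 1 / real p ^ (i - 1)" by (cases "n = 0") auto
  finally show ?thesis .
qed

text \<open>The second difference in \<open>chain_count_eq\<close> becomes
  \<open>1 / p ^ (i - 1) - 2 / p ^ i + 1 / p ^ (i + 1)\<close>, which is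
  \<open>(p - 1)^2 / p ^ (i + 1)\<close>.\<close>

lemma tendsto_chain_count:
  assumes p: "2 \<le> p" and i: "1 \<le> i"
  shows "(\<lambda>n. real (chain_count p n i) / real n)
    \<longlonglongrightarrow> (real p - 1)\<^sup>2 / (real p)\<^sup>2 / real p ^ (i - 1)"
proof -
  have "(\<lambda>n. real (n div p ^ (i - 1)) / real n - 2 * (real (n div p ^ i) / real n)
      + real (n div p ^ (i + 1)) / real n)
    \<longlonglongrightarrow> 1 / real (p ^ (i - 1)) - 2 * (1 / real (p ^ i)) + 1 / real (p ^ (i + 1))"
    by (intro tendsto_add tendsto_diff tendsto_mult tendsto_const tendsto_nat_div_over)
      (use p in auto)
  moreover have "1 / real (p ^ (i - 1)) - 2 * (1 / real (p ^ i)) + 1 / real (p ^ (i + 1))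
      = (real p - 1)\<^sup>2 / (real p)\<^sup>2 / real p ^ (i - 1)"
  proof -
    obtain a where a: "i = Suc a" using i by (cases i) auto
    show ?thesis using p unfolding a by (simp add: field_simps power2_eq_square)
  qed
  ultimately show ?thesis
    by (simp add: chain_count_eq[OF p i] add_divide_distrib diff_divide_distrib)
qed

lemma chain_length_pos:
  assumes "2 \<le> p" "1 \<le> q" "q \<le> n"
  shows "1 \<le> chain_length p n q"
  using less_chain_length_iff[OF assms(1,2), of 0 n] assms(3) by simp

text \<open>Grouping by length tuples: the starts are chosen independently in each coordinate, so
  each group has product size. The sum runs over all of \<open>tuples k\<close>, a domain
  independent of \<open>n\<close>, in preparation for the limit.\<close>

lemma sum_chain_lengths:
  fixes G :: "(nat \<Rightarrow> nat) \<Rightarrow> real"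
  assumes p: "\<And>j. j \<in> {1..k} \<Longrightarrow> 2 \<le> p j"
  shows "(\<Sum>q\<in>chain_starts k p n. G (chain_lengths k p n q)) =
    infsetsum (\<lambda>i. (\<Prod>j\<in>{1..k}. real (chain_count (p j) n (i j))) * G i) (tuples k)"
proof -
  let ?Q = "chain_starts k p n" and ?l = "chain_lengths k p n"
  have cnt: "real (card {q \<in> ?Q. ?l q = i}) = (\<Prod>j\<in>{1..k}. real (chain_count (p j) n (i j)))"
    if i: "i \<in> tuples k" for i
  proof -
    have "{q \<in> ?Q. ?l q = i} =
        (\<Pi>\<^sub>E j\<in>{1..k}. {q \<in> {1..n}. \<not> p j dvd q \<and> chain_length (p j) n q = i j})"
    proof (rule set_eqI)
      fix q
      have "?l q = i \<longleftrightarrow> (\<forall>j\<in>{1..k}. chain_length (p j) n (q j) = i j)"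
      proof
        assume r: "\<forall>j\<in>{1..k}. chain_length (p j) n (q j) = i j"
        have "?l q = restrict i {1..k}"
          unfolding chain_lengths_def using r by (intro restrict_ext) auto
        also have "\<dots> = i" using i unfolding tuples_def by (rule PiE_restrict)
        finally show "?l q = i" .
      qed (auto simp: chain_lengths_def)
      then show "q \<in> {q \<in> ?Q. ?l q = i} \<longleftrightarrow>
          q \<in> (\<Pi>\<^sub>E j\<in>{1..k}. {q \<in> {1..n}. \<not> p j dvd q \<and> chain_length (p j) n q = i j})"
        by (auto simp: chain_starts_def PiE_iff)
    qed
    then show ?thesis by (simp add: card_PiE chain_count_def)
  qed
  have sub: "?l ` ?Q \<subseteq> tuples k"
  proof (rule image_subsetI)
    fix q assume q: "q \<in> ?Q"
    show "?l q \<in> tuples k"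
      unfolding chain_lengths_def tuples_def
    proof (intro restrict_PiE_iff[THEN iffD2] ballI)
      fix j assume j: "j \<in> {1..k}"
      then have "1 \<le> q j" "q j \<le> n" using q by (auto simp: chain_starts_def)
      from chain_length_pos[OF p[OF j] this] show "chain_length (p j) n (q j) \<in> {1..}" by simp
    qed
  qed
  have "(\<Sum>q\<in>?Q. G (?l q)) = (\<Sum>i\<in>?l ` ?Q. \<Sum>q | q \<in> ?Q \<and> ?l q = i. G (?l q))"
    by (rule sum.image_gen[OF finite_chain_starts])
  also have "\<dots> = (\<Sum>i\<in>?l ` ?Q. (\<Prod>j\<in>{1..k}. real (chain_count (p j) n (i j))) * G i)"
  proof (rule sum.cong[OF refl])
    fix i assume "i \<in> ?l ` ?Q"
    then have "i \<in> tuples k" using sub by blast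
    from cnt[OF this] show "(\<Sum>q | q \<in> ?Q \<and> ?l q = i. G (?l q)) =
        (\<Prod>j\<in>{1..k}. real (chain_count (p j) n (i j))) * G i"
      by simp
  qed
  also have "\<dots> = infsetsum (\<lambda>i. (\<Prod>j\<in>{1..k}. real (chain_count (p j) n (i j))) * G i) (?l ` ?Q)"
    by (simp add: finite_chain_starts)
  also have "\<dots> = infsetsum (\<lambda>i. (\<Prod>j\<in>{1..k}. real (chain_count (p j) n (i j))) * G i) (tuples k)"
  \<comment> \<open>A tuple that is not attained has an empty group, so its product of counts is
    0.\<close>
  proof (rule infsetsum_cong_neutral)
    fix i assume i: "i \<in> tuples k - ?l ` ?Q"
    then have empty: "{q \<in> ?Q. ?l q = i} = {}" by blast
    have "i \<in> tuples k" using i by blast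
    from cnt[OF this] have "(\<Prod>j\<in>{1..k}. real (chain_count (p j) n (i j))) = 0"
      unfolding empty by simp
    then show "(\<Prod>j\<in>{1..k}. real (chain_count (p j) n (i j))) * G i = 0"
      by (simp only: mult_zero_left)
  qed (use sub in auto)
  finally show ?thesis .
qed

text \<open>A product of \<open>k\<close> absolutely convergent series; each factor is the
  derivative of the geometric series at \<open>1 / p j\<close>.\<close>

lemma integrable_tuples_weight:
  assumes p: "\<And>j. j \<in> {1..k} \<Longrightarrow> 2 \<le> p j"
  shows "integrable (count_space (tuples k)) (\<lambda>i. \<Prod>j\<in>{1..k}. real (i j) / real (p j) ^ (i j - 1))"
  unfolding tuples_def Infinite_Set_Sum.abs_summable_on_def[symmetric]
proof (rule abs_summable_on_prod_PiE)
  fix j assume j: "j \<in> {1..k}"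
  have "norm (1 / real (p j)) < 1" using p[OF j] by simp
  from sums_summable[OF geometric_deriv_sums[OF this]]
  have "summable (\<lambda>m. real (Suc m) / real (p j) ^ (Suc m - 1))"
    by (simp add: power_divide)
  then have "summable (\<lambda>m. real m / real (p j) ^ (m - 1))"
    by (subst summable_Suc_iff[symmetric])
  then have "Infinite_Set_Sum.abs_summable_on (\<lambda>m. real m / real (p j) ^ (m - 1)) UNIV"
    by (subst abs_summable_on_nat_iff') simp
  then show "Infinite_Set_Sum.abs_summable_on (\<lambda>m. real m / real (p j) ^ (m - 1)) {1..}"
    by (rule abs_summable_on_subset) simp
qed auto

section \<open>Normalized counts, dominated convergence and the entropy formula\<close>

lemma prod_split_at:
  fixes f g :: "nat \<Rightarrow> real"
  assumes "k \<le> d"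
  shows "(\<Prod>j\<in>{1..d}. if j \<le> k then f j else g j) = (\<Prod>j\<in>{1..k}. f j) * (\<Prod>j\<in>{k+1..d}. g j)"
proof -
  have "{1..d} = {1..k} \<union> {k+1..d}" using assms by auto
  moreover have "(\<Prod>j\<in>{1..k} \<union> {k+1..d}. if j \<le> k then f j else g j) =
      (\<Prod>j\<in>{1..k}. if j \<le> k then f j else g j) * (\<Prod>j\<in>{k+1..d}. if j \<le> k then f j else g j)"
    by (rule prod.union_disjoint) auto
  ultimately show ?thesis by simp
qed

lemma lambda_net_nonneg: "0 \<le> lambda_net d k W i n"
  unfolding lambda_net_eq
  by (intro divide_nonneg_nonneg log_card_nonneg prod_nonneg) auto

text \<open>The logarithmic count is at most the volume times \<open>ln (card A)\<close>, and the
  free sides cancel. The bound does not depend on \<open>n\<close>.\<close>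

lemma lambda_net_le:
  assumes W: "W \<subseteq> configs A d" and A: "finite A" and k: "k \<le> d"
  shows "lambda_net d k W i n \<le> (\<Prod>j\<in>{1..k}. real (i j)) * ln (real (card A))"
proof -
  let ?P = "\<Prod>j\<in>{k+1..d}. real (n j)"
  have lnA: "0 \<le> ln (real (card A))" by (cases "card A") auto
  have P: "0 \<le> ?P" by (intro prod_nonneg) auto
  have "(\<Prod>j\<in>{1..d}. real (if j \<le> k then i j else n j)) = (\<Prod>j\<in>{1..k}. real (i j)) * ?P"
    by (subst prod_split_at[OF k, symmetric]) (auto intro!: prod.cong)
  then have "log_card d W (\<lambda>j. if j \<le> k then i j else n j) \<le>
      (\<Prod>j\<in>{1..k}. real (i j)) * ?P * ln (real (card A))"
    using log_card_le[OF W A, of "\<lambda>j. if j \<le> k then i j else n j"] by simp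
  then have "lambda_net d k W i n \<le> (\<Prod>j\<in>{1..k}. real (i j)) * ?P * ln (real (card A)) / ?P"
    unfolding lambda_net_eq using P by (rule divide_right_mono)
  also have "\<dots> \<le> (\<Prod>j\<in>{1..k}. real (i j)) * ln (real (card A))"
  proof (cases "?P = 0")
    case True
    \<comment> \<open>If a free side is 0, division by zero gives 0, so nonnegativity of the bound
      suffices.\<close>
    have "0 \<le> (\<Prod>j\<in>{1..k}. real (i j)) * ln (real (card A))"
      by (intro mult_nonneg_nonneg prod_nonneg lnA) auto
    then show ?thesis by (simp only: True div_by_0)
  next
    case False
    have "x * y * z / y = x * z" if "y \<noteq> 0" for x y z :: real using that by simp
    from this[OF False] show ?thesis by (rule eq_refl)
  qed
  finally show ?thesis .
qed

text \<open>The factor \<open>n ^ k\<close> of \<open>n ^ d\<close> normalizes the counts of orbits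
  to frequencies, and \<open>n ^ (d - k)\<close> is the denominator of \<open>lambda_net\<close> at
  equal free sides.\<close>

lemma entropy_seq_mult_axial_product:
  fixes A :: "'a set"
  assumes A: "finite A" and k: "k \<le> d" and p: "\<And>j. j \<in> {1..k} \<Longrightarrow> 2 \<le> p j"
  shows "entropy_seq d
      (axial_product A d (\<lambda>i. if i \<le> k then mult_subshift A (p i) (Y i) else Y i)) n =
    (\<integral>i. (\<Prod>j\<in>{1..k}. real (chain_count (p j) n (i j)) / real n)
        * lambda_net d k (axial_product A d Y) i (\<lambda>_. n) \<partial>count_space (tuples k))"
proof -
  let ?W = "axial_product A d Y"
  have "entropy_seq d
      (axial_product A d (\<lambda>i. if i \<le> k then mult_subshift A (p i) (Y i) else Y i)) n =
    (\<Sum>q\<in>chain_starts k p n. log_card d ?W (\<lambda>j. if j \<le> k then chain_lengths k p n q j else n)) /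
      real n ^ d"
    unfolding entropy_seq_def log_card_def[symmetric]
    by (subst log_card_mult_axial_product[OF k p A]) auto
  also have "\<dots> = infsetsum (\<lambda>i. (\<Prod>j\<in>{1..k}. real (chain_count (p j) n (i j)))
      * log_card d ?W (\<lambda>j. if j \<le> k then i j else n)) (tuples k) / real n ^ d"
    by (subst sum_chain_lengths[OF p, where G = "\<lambda>i. log_card d ?W (\<lambda>j. if j \<le> k then i j else n)"])
      auto
  also have "\<dots> = (\<integral>i. (\<Prod>j\<in>{1..k}. real (chain_count (p j) n (i j)))
      * log_card d ?W (\<lambda>j. if j \<le> k then i j else n) / real n ^ d \<partial>count_space (tuples k))"
    unfolding infsetsum_def by simp
  also have "\<dots> = (\<integral>i. (\<Prod>j\<in>{1..k}. real (chain_count (p j) n (i j)) / real n)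
        * lambda_net d k ?W i (\<lambda>_. n) \<partial>count_space (tuples k))"
  proof (rule Bochner_Integration.integral_cong[OF refl])
    fix i
    have "real n ^ d = real n ^ k * real n ^ (d - k)" using k by (simp flip: power_add)
    then show "(\<Prod>j\<in>{1..k}. real (chain_count (p j) n (i j)))
        * log_card d ?W (\<lambda>j. if j \<le> k then i j else n) / real n ^ d =
      (\<Prod>j\<in>{1..k}. real (chain_count (p j) n (i j)) / real n) * lambda_net d k ?W i (\<lambda>_. n)"
      by (simp add: lambda_net_eq prod_dividef)
  qed
  finally show ?thesis .
qed

theorem theorem5p1:
  fixes A :: "'a set" and d k :: nat and p :: "nat \<Rightarrow> nat"
    and \<Omega> X :: "nat \<Rightarrow> (nat \<Rightarrow> 'a) set"
  defines "Z \<equiv> axial_product A d (\<lambda>i. if i \<le> k then mult_subshift A (p i) (\<Omega> i) else X i)"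
    and "W \<equiv> axial_product A d (\<lambda>i. if i \<le> k then \<Omega> i else X i)"
  assumes "finite A" and "1 \<le> d" and "k \<le> d"
    and "\<forall>i\<in>{1..k}. 2 \<le> p i"
    and "\<forall>i\<in>{1..k}. subshift A (\<Omega> i)"
    and "\<forall>j\<in>{k+1..d}. subshift A (X j)"
  shows "(\<forall>i\<in>tuples k. \<exists>L. (lambda_net d k W i \<longlongrightarrow> L) (coords_at_top {k+1..d})) \<and>
    (\<lambda>i. lambda_lim d k W i / (\<Prod>j=1..k. real (p j) ^ (i j - 1))) summable_on tuples k \<and>
    convergent (entropy_seq d Z) \<and>
    entropy d Z = (\<Prod>i=1..k. (real (p i) - 1)\<^sup>2 / (real (p i))\<^sup>2) *
      (\<Sum>\<^sub>\<infinity>i\<in>tuples k. lambda_lim d k W i / (\<Prod>j=1..k. real (p j) ^ (i j - 1)))"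
proof -
  define Y where "Y i = (if i \<le> k then \<Omega> i else X i)" for i
  have p: "\<And>j. j \<in> {1..k} \<Longrightarrow> 2 \<le> p j" using assms(6) by blast
  have W: "W = axial_product A d Y" by (simp add: W_def Y_def[abs_def])
  have Z: "Z = axial_product A d (\<lambda>i. if i \<le> k then mult_subshift A (p i) (Y i) else Y i)"
    unfolding Z_def by (rule arg_cong[where f = "axial_product A d"]) (auto simp: Y_def fun_eq_iff)
  have sh: "shift ` Y j \<subseteq> Y j" if "j \<in> {k+1..d}" for j
    using assms(8) that by (auto simp: Y_def subshift_def)
  have ex: "\<exists>L. (lambda_net d k W i \<longlongrightarrow> L) (coords_at_top {k+1..d})" for i
    unfolding W by (rule lambda_net_converges[OF assms(3,5) sh])
  then have lim: "(lambda_net d k W i \<longlongrightarrow> lambda_lim d k W i) (coords_at_top {k+1..d})" for i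
    unfolding lambda_lim_def using tendsto_Lim[OF coords_at_top_neq_bot] by metis
  let ?M = "count_space (tuples k)"
  let ?s = "\<lambda>n i. (\<Prod>j\<in>{1..k}. real (chain_count (p j) n (i j)) / real n) * lambda_net d k W i (\<lambda>_. n)"
  let ?f = "\<lambda>i. (\<Prod>j\<in>{1..k}. (real (p j) - 1)\<^sup>2 / (real (p j))\<^sup>2 / real (p j) ^ (i j - 1))
    * lambda_lim d k W i"
  \<comment> \<open>The dominating function: \<open>chain_count_le\<close> bounds the frequencies
    and \<open>lambda_net_le\<close> the normalized logarithm, both uniformly in
    \<open>n\<close>.\<close>
  let ?w = "\<lambda>i. (\<Prod>j\<in>{1..k}. real (i j) / real (p j) ^ (i j - 1)) * ln (real (card A))"
  let ?g = "\<lambda>i. lambda_lim d k W i / (\<Prod>j=1..k. real (p j) ^ (i j - 1))"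
  let ?C = "\<Prod>j\<in>{1..k}. (real (p j) - 1)\<^sup>2 / (real (p j))\<^sup>2"
  have w: "integrable ?M ?w"
    by (intro integrable_mult_left integrable_tuples_weight p)
  have conv: "AE i in ?M. (\<lambda>n. ?s n i) \<longlonglongrightarrow> ?f i"
    unfolding AE_count_space
  proof
    fix i assume i: "i \<in> tuples k"
    \<comment> \<open>For fixed \<open>i\<close> the frequencies converge, and
      \<open>lambda_net\<close> is followed along the diagonal of its limit.\<close>
    show "(\<lambda>n. ?s n i) \<longlonglongrightarrow> ?f i"
      by (intro tendsto_mult tendsto_prod tendsto_chain_count p tuplesD[OF i]
          filterlim_compose[OF lim filterlim_diag_coords_at_top])
  qed
  have bound: "AE i in ?M. norm (?s n i) \<le> ?w i" for n
    unfolding AE_count_space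
  proof
    fix i assume i: "i \<in> tuples k"
    have "?s n i \<le> (\<Prod>j\<in>{1..k}. 1 / real (p j) ^ (i j - 1)) * ((\<Prod>j\<in>{1..k}. real (i j)) * ln (real (card A)))"
      using axial_product_subset_configs W
      by (intro mult_mono prod_mono conjI chain_count_le p tuplesD[OF i] lambda_net_nonneg
          lambda_net_le[OF _ assms(3,5)] prod_nonneg) auto
    also have "\<dots> = ?w i" by (simp add: prod_dividef)
    finally have "?s n i \<le> ?w i" .
    moreover have "0 \<le> ?s n i" by (intro mult_nonneg_nonneg prod_nonneg lambda_net_nonneg) auto
    ultimately show "norm (?s n i) \<le> ?w i" by simp
  qed
  have int: "integrable ?M ?f"
    by (rule integrable_dominated_convergence[OF _ _ w conv bound]) simp_all
  have "(\<lambda>n. \<integral>i. ?s n i \<partial>?M) \<longlonglongrightarrow> (\<integral>i. ?f i \<partial>?M)"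
    by (rule integral_dominated_convergence[OF _ _ w conv bound]) simp_all
  moreover have eq: "entropy_seq d Z = (\<lambda>n. \<integral>i. ?s n i \<partial>?M)"
    unfolding Z W by (rule ext, rule entropy_seq_mult_axial_product[OF assms(3,5)]) (rule p)
  ultimately have tend: "entropy_seq d Z \<longlonglongrightarrow> (\<integral>i. ?f i \<partial>?M)"
    unfolding eq by blast
  have f: "?f i = ?C * ?g i" for i
    by (simp add: prod_dividef prod.distrib)
  \<comment> \<open>Since \<open>p j \<ge> 2\<close>, the constant can be divided out, which carries
    integrability from \<open>?f\<close> over to \<open>?g\<close>.\<close>
  have C0: "?C \<noteq> 0" using p by (force simp: prod_zero_iff)
  have "inverse ?C * (?C * x) = x" for x
    unfolding mult.assoc[symmetric] left_inverse[OF C0] by simp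
  then have g: "integrable ?M ?g"
    using integrable_mult_right[OF int, of "inverse ?C"] unfolding f by (simp only:)
  \<comment> \<open>Integrability over the counting measure is absolute summability, which links the
    integral with \<open>infsum\<close>.\<close>
  have abs: "Infinite_Set_Sum.abs_summable_on ?g (tuples k)"
    using g unfolding Infinite_Set_Sum.abs_summable_on_def .
  have "?g summable_on tuples k"
    using abs unfolding abs_summable_equivalent[symmetric] by (rule abs_summable_summable)
  moreover have "(\<integral>i. ?f i \<partial>?M) = ?C * infsum ?g (tuples k)"
    unfolding f infsetsum_infsum[OF abs, symmetric] infsetsum_def
    by (rule Bochner_Integration.integral_mult_right_zero)
  ultimately show ?thesis
    using ex tend unfolding entropy_def convergent_def by (auto dest: limI)
qed

end
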